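(* Let $(\mathfrak g,J,g)$ be a Kähler Lie algebra such that $g$ is a Walker metric, with a subspace $W\subset\mathfrak g$ satisfying $g(W,W)=0$ and $\nabla_yW\subset W$ for all $y\in\mathfrak g$, where $\nabla$ is the Levi-Civita connection of $g$. Assume that $\mathfrak g=W\oplus JW$ (direct sum of vector subspaces). Then $g$ is a hypersymplectic metric on $\mathfrak g$.
   Context: All Lie algebras are real. A complex structure is an endomorphism $J$ with $J^2=-I$ and $[Jx,Jy]-[x,y]-J[Jx,y]-J[x,Jy]=0$. A Kähler Lie algebra is a Lie algebra with a complex structure $J$ and a closed nondegenerate 2-form $\omega$ (closed: $\omega([x,y],z)+\omega([y,z],x)+\omega([z,x],y)=0$) with $\omega(Jx,Jy)=\omega(x,y)$; the associated pseudo-Kähler metric is $g(x,y)=\omega(Jx,y)$, not necessarily definite, and one writes $(\mathfrak g,J,g)$. The Levi-Civita connection is given by $2g(\nabla_xy,z)=g([x,y],z)-g([y,z],x)+g([z,x],y)$. A hypersymplectic Lie algebra is $(\mathfrak g,J,E,g)$ where $J$ is a complex structure, $E$ is a product structure ($E^2=I$, $E\neq\pm I$, with the $\pm1$ eigenspaces $\mathfrak g_\pm$ subalgebras) that anticommutes with $J$, and $g$ is a pseudo-Riemannian metric compatible with both ($g(Jx,Jy)=g(x,y)$, $g(Ex,Ey)=-g(x,y)$) such that the associated 2-forms $g(Jx,y)$, $g(Ex,y)$, $g(JEx,y)$ are closed. A metric $g$ on $\mathfrak g$ is hypersymplectic if it is part of such a structure. *)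

theory Defs
  imports "HOL-Analysis.Analysis"
begin

text \<open>
  A Lie algebra is carried by a whole type of class \<open>real_vector\<close>, its bracket being an explicit
  argument \<open>br\<close>. Lie algebras are finite-dimensional, as is implicit in speaking of the
  Levi-Civita connection of a nondegenerate metric.
\<close>

definition lie_algebra :: "('a::real_vector \<Rightarrow> 'a \<Rightarrow> 'a) \<Rightarrow> bool" where
  "lie_algebra br \<longleftrightarrow>
     (\<exists>B. finite B \<and> span B = (UNIV :: 'a set)) \<and>
     bilinear br \<and>
     (\<forall>x. br x x = 0) \<and>
     (\<forall>x y z. br (br x y) z + br (br y z) x + br (br z x) y = 0)"

definition lie_subalgebra :: "('a::real_vector \<Rightarrow> 'a \<Rightarrow> 'a) \<Rightarrow> 'a set \<Rightarrow> bool" where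
  "lie_subalgebra br S \<longleftrightarrow> subspace S \<and> (\<forall>x\<in>S. \<forall>y\<in>S. br x y \<in> S)"

definition complex_structure ::
    "('a::real_vector \<Rightarrow> 'a \<Rightarrow> 'a) \<Rightarrow> ('a \<Rightarrow> 'a) \<Rightarrow> bool" where
  "complex_structure br J \<longleftrightarrow>
     linear J \<and>
     (\<forall>x. J (J x) = - x) \<and>
     (\<forall>x y. br (J x) (J y) - br x y - J (br (J x) y) - J (br x (J y)) = 0)"

definition product_structure ::
    "('a::real_vector \<Rightarrow> 'a \<Rightarrow> 'a) \<Rightarrow> ('a \<Rightarrow> 'a) \<Rightarrow> bool" where
  "product_structure br E \<longleftrightarrow>
     linear E \<and>
     (\<forall>x. E (E x) = x) \<and>
     E \<noteq> (\<lambda>x. x) \<and> E \<noteq> (\<lambda>x. - x) \<and>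
     lie_subalgebra br {x. E x = x} \<and>
     lie_subalgebra br {x. E x = - x}"

definition nondegenerate :: "('a::real_vector \<Rightarrow> 'a \<Rightarrow> real) \<Rightarrow> bool" where
  "nondegenerate b \<longleftrightarrow>
     (\<forall>x. (\<forall>y. b x y = 0) \<longrightarrow> x = 0) \<and> (\<forall>y. (\<forall>x. b x y = 0) \<longrightarrow> y = 0)"

definition two_form :: "('a::real_vector \<Rightarrow> 'a \<Rightarrow> real) \<Rightarrow> bool" where
  "two_form \<omega> \<longleftrightarrow> bilinear \<omega> \<and> (\<forall>x y. \<omega> x y = - \<omega> y x)"

definition closed_two_form ::
    "('a::real_vector \<Rightarrow> 'a \<Rightarrow> 'a) \<Rightarrow> ('a \<Rightarrow> 'a \<Rightarrow> real) \<Rightarrow> bool" where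
  "closed_two_form br \<omega> \<longleftrightarrow>
     two_form \<omega> \<and> (\<forall>x y z. \<omega> (br x y) z + \<omega> (br y z) x + \<omega> (br z x) y = 0)"

definition pseudo_riemannian_metric :: "('a::real_vector \<Rightarrow> 'a \<Rightarrow> real) \<Rightarrow> bool" where
  "pseudo_riemannian_metric g \<longleftrightarrow>
     bilinear g \<and> (\<forall>x y. g x y = g y x) \<and> nondegenerate g"

definition kaehler_lie_algebra ::
    "('a::real_vector \<Rightarrow> 'a \<Rightarrow> 'a) \<Rightarrow> ('a \<Rightarrow> 'a) \<Rightarrow> ('a \<Rightarrow> 'a \<Rightarrow> real) \<Rightarrow> bool" where
  "kaehler_lie_algebra br J \<omega> \<longleftrightarrow>
     lie_algebra br \<and>
     complex_structure br J \<and>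
     closed_two_form br \<omega> \<and> nondegenerate \<omega> \<and>
     (\<forall>x y. \<omega> (J x) (J y) = \<omega> x y)"

definition kaehler_metric ::
    "('a \<Rightarrow> 'a) \<Rightarrow> ('a::real_vector \<Rightarrow> 'a \<Rightarrow> real) \<Rightarrow> 'a \<Rightarrow> 'a \<Rightarrow> real" where
  "kaehler_metric J \<omega> = (\<lambda>x y. \<omega> (J x) y)"

text \<open>
  \<open>levi_civita br g x y\<close> is \<open>\<nabla>\<^sub>x y\<close>. The description is well defined when \<open>g\<close> is a
  pseudo-Riemannian metric, by nondegeneracy and finite dimension.
\<close>

definition levi_civita ::
    "('a::real_vector \<Rightarrow> 'a \<Rightarrow> 'a) \<Rightarrow> ('a \<Rightarrow> 'a \<Rightarrow> real) \<Rightarrow> 'a \<Rightarrow> 'a \<Rightarrow> 'a" where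
  "levi_civita br g x y =
     (THE v. \<forall>z. 2 * g v z = g (br x y) z - g (br y z) x + g (br z x) y)"

text \<open>
  A Walker metric is one admitting a nontrivial parallel null subspace. Nontriviality matters
  only for the zero Lie algebra, which carries no product structure.
\<close>

definition walker_subspace ::
    "('a::real_vector \<Rightarrow> 'a \<Rightarrow> 'a) \<Rightarrow> ('a \<Rightarrow> 'a \<Rightarrow> real) \<Rightarrow> 'a set \<Rightarrow> bool" where
  "walker_subspace br g W \<longleftrightarrow>
     subspace W \<and> W \<noteq> {0} \<and>
     (\<forall>u\<in>W. \<forall>w\<in>W. g u w = 0) \<and>
     (\<forall>y. \<forall>w\<in>W. levi_civita br g y w \<in> W)"

definition direct_sum_decomposition :: "'a::real_vector set \<Rightarrow> 'a set \<Rightarrow> bool" where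
  "direct_sum_decomposition U V \<longleftrightarrow>
     subspace U \<and> subspace V \<and> U \<inter> V = {0} \<and> {u + v |u v. u \<in> U \<and> v \<in> V} = UNIV"

definition hypersymplectic_lie_algebra ::
    "('a::real_vector \<Rightarrow> 'a \<Rightarrow> 'a) \<Rightarrow> ('a \<Rightarrow> 'a) \<Rightarrow> ('a \<Rightarrow> 'a) \<Rightarrow> ('a \<Rightarrow> 'a \<Rightarrow> real) \<Rightarrow> bool" where
  "hypersymplectic_lie_algebra br J E g \<longleftrightarrow>
     lie_algebra br \<and>
     complex_structure br J \<and>
     product_structure br E \<and>
     (\<forall>x. J (E x) = - E (J x)) \<and>
     pseudo_riemannian_metric g \<and>
     (\<forall>x y. g (J x) (J y) = g x y) \<and>
     (\<forall>x y. g (E x) (E y) = - g x y) \<and>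
     closed_two_form br (\<lambda>x y. g (J x) y) \<and>
     closed_two_form br (\<lambda>x y. g (E x) y) \<and>
     closed_two_form br (\<lambda>x y. g (J (E x)) y)"

definition hypersymplectic_metric ::
    "('a::real_vector \<Rightarrow> 'a \<Rightarrow> 'a) \<Rightarrow> ('a \<Rightarrow> 'a \<Rightarrow> real) \<Rightarrow> bool" where
  "hypersymplectic_metric br g \<longleftrightarrow> (\<exists>J E. hypersymplectic_lie_algebra br J E g)"

end

theory Submission
  imports Defs
begin

text \<open>
  Keep \<open>J\<close> and let \<open>E\<close> be \<open>1\<close> on \<open>W\<close> and \<open>-1\<close> on \<open>JW\<close>. The algebraic conditions are immediate: \<open>J\<close> interchanges the two summands, so it anticommutes with \<open>E\<close>, and both summands
  are null (\<open>JW\<close> because \<open>J\<close> is an isometry), so \<open>g\<close> pairs only \<open>W\<close> with \<open>JW\<close>, where \<open>E\<close>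
  reverses its sign.

  The differential conditions all come from the fact that \<open>E\<close> is parallel. The Levi-Civita
  connection of a pseudo-Kaehler metric commutes with \<open>J\<close> (lemma \<open>kaehler_parallel\<close>), so along with
  \<open>W\<close> it preserves \<open>JW\<close>, that is, \<open>\<nabla>E = 0\<close>. Since \<open>[x,y] = \<nabla>\<^sub>x y - \<nabla>\<^sub>y x\<close>, parallel subspaces are
  subalgebras (lemma \<open>parallel_subspace_subalgebra\<close>), which gives integrability of \<open>E\<close>; and for a
  skew-adjoint parallel endomorphism \<open>A\<close> the form \<open>g(A x, y)\<close> is closed (lemma
  \<open>parallel_skew_closed\<close>), which applies to \<open>E\<close> and to \<open>JE\<close>.
\<close>

section \<open>Nondegenerate forms in finite dimension\<close>

text \<open>
  In a basis \<open>B\<close>, the map sending \<open>v\<close> to the vector with coordinates \<open>b v e\<close>, \<open>e \<in> B\<close>, is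
  injective by nondegeneracy, hence surjective.
\<close>

lemma nondegenerate_represents_functional:
  fixes b :: "'a::real_vector \<Rightarrow> 'a \<Rightarrow> real"
  assumes fin: "finite S" "span S = (UNIV :: 'a set)"
    and bil: "bilinear b" and nd: "nondegenerate b" and f: "linear f"
  shows "\<exists>v. \<forall>z. b v z = f z"
proof -
  obtain B where B: "B \<subseteq> S" "independent B" "span B = (UNIV :: 'a set)"
    using maximal_independent_subset[of S] fin(2)
    by (metis span_mono span_span top.extremum_uniqueI)
  have finB: "finite B" using B(1) fin(1) finite_subset by blast
  interpret fd: finite_dimensional_vector_space "scaleR :: real \<Rightarrow> 'a \<Rightarrow> 'a" B
    by unfold_locales (use finB B in \<open>auto simp: dependent_raw_def span_raw_def\<close>)
  define \<phi> where "\<phi> v = (\<Sum>e\<in>B. b v e *\<^sub>R e)" for v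
  have lin: "linear \<phi>"
    by (rule linearI)
      (simp_all add: \<phi>_def bilinear_ladd[OF bil] bilinear_lmul[OF bil] scaleR_add_left
        sum.distrib scaleR_sum_right)
  have agree: "h = k" if "linear h" "linear k" "\<And>e. e \<in> B \<Longrightarrow> h e = k e" for h k :: "'a \<Rightarrow> real"
    using linear_eq_on_span[OF that(1,2), of B] that(3) B(3) by (metis UNIV_I ext)
  have linb: "linear (b v)" for v using bil by (simp add: bilinear_def)
  have coord: "c e = d e" if "(\<Sum>e\<in>B. c e *\<^sub>R e) = (\<Sum>e\<in>B. d e *\<^sub>R e)" "e \<in> B"
    for c d :: "'a \<Rightarrow> real" and e
  proof -
    have "(\<Sum>e\<in>B. (c e - d e) *\<^sub>R e) = 0"
      using that(1) by (simp add: scaleR_diff_left sum_subtractf)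
    then have "c e - d e = 0" using independentD[OF B(2) finB subset_refl, of "\<lambda>e. c e - d e" e] that(2) by simp
    then show ?thesis by simp
  qed
  have "inj \<phi>"
  proof (subst linear_injective_0[OF lin], intro allI impI)
    fix v assume "\<phi> v = 0"
    then have "b v e = 0" if "e \<in> B" for e
      using coord[of "b v" "\<lambda>_. 0"] that by (simp add: \<phi>_def)
    then have "b v = (\<lambda>_. 0)" by (intro agree linb) (simp_all add: linear_iff)
    then show "v = 0" using nd by (simp add: nondegenerate_def)
  qed
  then have "surj \<phi>"
    using fd.linear_inj_imp_surj lin by (simp add: linear_def)
  then obtain v where v: "\<phi> v = (\<Sum>e\<in>B. f e *\<^sub>R e)" by (metis surjD)
  have "b v = f"
    by (rule agree[OF linb f]) (use v coord in \<open>simp add: \<phi>_def\<close>)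
  then show ?thesis by auto
qed

section \<open>The Levi-Civita connection\<close>

context
  fixes br :: "'a::real_vector \<Rightarrow> 'a \<Rightarrow> 'a" and g :: "'a \<Rightarrow> 'a \<Rightarrow> real"
  assumes lie: "lie_algebra br" and metric: "pseudo_riemannian_metric g"
begin

abbreviation nabla :: "'a \<Rightarrow> 'a \<Rightarrow> 'a" where
  "nabla \<equiv> levi_civita br g"

lemma bilinear_bracket: "bilinear br"
  using lie by (simp add: lie_algebra_def)

lemma bracket_skew: "br x y = - br y x"
proof -
  have "br (x + y) (x + y) = 0" "br x x = 0" "br y y = 0"
    using lie by (simp_all add: lie_algebra_def)
  then have "br x y + br y x = 0"
    using bilinear_bracket by (simp add: bilinear_ladd bilinear_radd)
  then show ?thesis by (simp add: eq_neg_iff_add_eq_0)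
qed

lemma bilinear_metric: "bilinear g"
  using metric by (simp add: pseudo_riemannian_metric_def)

lemma metric_sym: "g x y = g y x"
  using metric by (simp add: pseudo_riemannian_metric_def)

lemmas metric_simps =
  bilinear_ladd[OF bilinear_metric] bilinear_radd[OF bilinear_metric]
  bilinear_lsub[OF bilinear_metric] bilinear_rsub[OF bilinear_metric]
  bilinear_lneg[OF bilinear_metric] bilinear_rneg[OF bilinear_metric]

lemma metric_eqI:
  assumes "\<And>z. g u z = g v z"
  shows "u = v"
proof -
  have "\<forall>z. g (u - v) z = 0" using assms by (simp add: metric_simps)
  then show ?thesis
    using metric unfolding pseudo_riemannian_metric_def nondegenerate_def by fastforce
qed

lemma koszul: "2 * g (nabla x y) z = g (br x y) z - g (br y z) x + g (br z x) y"
proof -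
  let ?f = "\<lambda>z. (g (br x y) z - g (br y z) x + g (br z x) y) / 2"
  obtain S where S: "finite S" "span S = (UNIV :: 'a set)"
    using lie by (auto simp: lie_algebra_def)
  have "linear ?f"
    by (rule linearI)
      (simp_all add: metric_simps bilinear_ladd[OF bilinear_bracket]
        bilinear_radd[OF bilinear_bracket] bilinear_lmul[OF bilinear_bracket]
        bilinear_rmul[OF bilinear_bracket] bilinear_lmul[OF bilinear_metric]
        bilinear_rmul[OF bilinear_metric] algebra_simps add_divide_distrib diff_divide_distrib)
  then obtain v where v: "\<forall>z. g v z = ?f z"
    using nondegenerate_represents_functional[OF S bilinear_metric] metric
    unfolding pseudo_riemannian_metric_def by blast
  let ?P = "\<lambda>v. \<forall>z. 2 * g v z = g (br x y) z - g (br y z) x + g (br z x) y"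
  have "?P v" using v by (simp add: mult.commute)
  moreover have "w = v" if "?P w" for w
    by (rule metric_eqI) (use that \<open>?P v\<close> in \<open>metis mult_cancel_left zero_neq_numeral\<close>)
  ultimately have "?P (THE v. ?P v)" by (rule theI)
  then show ?thesis unfolding levi_civita_def by blast
qed

lemma torsion_free: "nabla x y - nabla y x = br x y"
proof (rule metric_eqI)
  fix z
  have "2 * g (nabla x y - nabla y x) z = 2 * g (br x y) z"
    using koszul[of x y z] koszul[of y x z] bracket_skew[of y x] bracket_skew[of y z]
      bracket_skew[of x z]
    by (simp add: metric_simps algebra_simps)
  then show "g (nabla x y - nabla y x) z = g (br x y) z" by simp
qed

lemma nabla_skew: "g (nabla x y) z = - g y (nabla x z)"
proof -
  have "2 * g (nabla x y) z + 2 * g (nabla x z) y = 0"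
    using koszul[of x y z] koszul[of x z y] bracket_skew[of y x] bracket_skew[of y z]
      bracket_skew[of x z]
    by (simp add: metric_simps)
  then show ?thesis by (simp add: metric_sym[of y])
qed

lemma nabla_add: "nabla x (y + z) = nabla x y + nabla x z"
proof (rule metric_eqI)
  fix w show "g (nabla x (y + z)) w = g (nabla x y + nabla x z) w"
    by (simp add: metric_simps nabla_skew)
qed

lemma nabla_minus: "nabla x (- y) = - nabla x y"
proof (rule metric_eqI)
  fix w show "g (nabla x (- y)) w = g (- nabla x y) w"
    by (simp add: metric_simps nabla_skew)
qed

lemma parallel_subspace_subalgebra:
  assumes "subspace U" "\<And>x u. u \<in> U \<Longrightarrow> nabla x u \<in> U"
  shows "lie_subalgebra br U"
  unfolding lie_subalgebra_def using assms torsion_free by (metis subspace_diff)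

text \<open>
  The trilinear form \<open>S(x,y,z) = g(A \<nabla>\<^sub>x y, z)\<close> is symmetric in \<open>y, z\<close>: moving \<open>A\<close> through
  \<open>\<nabla>\<^sub>x\<close> and then both across \<open>g\<close> costs two signs. Torsion-freeness writes each term of the
  differential as \<open>S(x,y,z) - S(y,x,z)\<close>, and the cyclic sum cancels.
\<close>

lemma parallel_skew_closed:
  assumes lin: "linear A" and skew: "\<And>x y. g (A x) y = - g x (A y)"
    and par: "\<And>x y. nabla x (A y) = A (nabla x y)"
  shows "closed_two_form br (\<lambda>x y. g (A x) y)"
proof -
  have bil: "bilinear (\<lambda>x y. g (A x) y)"
    using bilinear_metric linear_compose[OF lin, of "\<lambda>x. g x y" for y] unfolding bilinear_def
    by (simp add: o_def)
  have sym: "g (A (nabla x y)) z = g (A (nabla x z)) y" for x y z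
    using nabla_skew[of x "A y" z] skew[of y "nabla x z"] metric_sym[of y] par by simp
  have br: "g (A (br x y)) z = g (A (nabla x y)) z - g (A (nabla y x)) z" for x y z
    using torsion_free[of x y] by (metis linear_diff[OF lin] bilinear_lsub[OF bilinear_metric])
  have "g (A (br x y)) z + g (A (br y z)) x + g (A (br z x)) y = 0" for x y z
    using sym[of x y z] sym[of y z x] sym[of z x y] by (simp add: br)
  moreover have "g (A x) y = - g (A y) x" for x y
    using skew[of x y] metric_sym by simp
  ultimately show ?thesis unfolding closed_two_form_def two_form_def using bil by blast
qed

end

section \<open>Kaehler metrics\<close>

context
  fixes br :: "'a::real_vector \<Rightarrow> 'a \<Rightarrow> 'a" and J :: "'a \<Rightarrow> 'a" and \<omega> g :: "'a \<Rightarrow> 'a \<Rightarrow> real"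
  assumes kaehler: "kaehler_lie_algebra br J \<omega>" and g: "g = kaehler_metric J \<omega>"
begin

lemma kaehler_lie: "lie_algebra br"
  using kaehler by (simp add: kaehler_lie_algebra_def)

lemma linear_J: "linear J" and J_J: "J (J x) = - x"
  using kaehler by (simp_all add: kaehler_lie_algebra_def complex_structure_def)

lemma bilinear_form: "bilinear \<omega>"
  using kaehler by (simp add: kaehler_lie_algebra_def closed_two_form_def two_form_def)

lemma form_eq: "\<omega> x y = - g (J x) y"
  by (simp add: g kaehler_metric_def J_J bilinear_lneg[OF bilinear_form])

lemma J_isometry: "g (J x) (J y) = g x y"
  using kaehler by (simp add: g kaehler_metric_def kaehler_lie_algebra_def)

lemma kaehler_metric_pseudo_riemannian: "pseudo_riemannian_metric g"
proof -
  have skew: "\<And>x y. \<omega> x y = - \<omega> y x" and inv: "\<And>x y. \<omega> (J x) (J y) = \<omega> x y"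
    and nondeg: "nondegenerate \<omega>"
    using kaehler unfolding kaehler_lie_algebra_def closed_two_form_def two_form_def by blast+
  have bil: "bilinear g"
    using bilinear_form linear_compose[OF linear_J, of "\<lambda>x. \<omega> x y" for y]
    unfolding g kaehler_metric_def bilinear_def by (simp add: o_def)
  have sym: "g x y = g y x" for x y
    using inv[of "J x" y] skew[of x "J y"] bilinear_lneg[OF bilinear_form, of x]
    by (simp add: g kaehler_metric_def J_J)
  have "x = 0" if "\<forall>y. g x y = 0" for x
  proof -
    have "J x = 0" using nondeg that by (simp add: nondegenerate_def g kaehler_metric_def)
    then show ?thesis using J_J[of x] linear_0[OF linear_J] by simp
  qed
  then have "nondegenerate g" unfolding nondegenerate_def using sym by metis
  then show ?thesis unfolding pseudo_riemannian_metric_def using bil sym by blast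
qed

lemma J_skew: "g (J x) y = - g x (J y)"
  using J_isometry[of x "J y"] bilinear_rneg[OF bilinear_metric[OF kaehler_lie kaehler_metric_pseudo_riemannian]]
  by (simp add: J_J)

text \<open>
  By the Koszul formula \<open>2 g((\<nabla>\<^sub>x J) y, z) = d\<omega>(x, y, z) - d\<omega>(x, J y, J z) + g(N(y, z), J x)\<close>,
  where \<open>d\<omega>\<close> is the cyclic sum of \<open>\<omega>([x, y], z)\<close> and \<open>N\<close> is the Nijenhuis tensor
  \<open>[J y, J z] - [y, z] - J [J y, z] - J [y, J z]\<close>; all three terms vanish.
\<close>

lemma kaehler_parallel: "levi_civita br g x (J y) = J (levi_civita br g x y)"
proof (rule metric_eqI[OF kaehler_lie kaehler_metric_pseudo_riemannian])
  fix z
  note pr = kaehler_metric_pseudo_riemannian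
  note bil = bilinear_metric[OF kaehler_lie pr]
  note ks = koszul[OF kaehler_lie pr]
  have closed: "g (br u v) (J w) + g (br v w) (J u) + g (br w u) (J v) = 0" for u v w
  proof -
    have "\<omega> (br u v) w + \<omega> (br v w) u + \<omega> (br w u) v = 0"
      using kaehler by (simp add: kaehler_lie_algebra_def closed_two_form_def)
    then show ?thesis by (simp add: form_eq J_skew)
  qed
  have N: "br (J y) (J z) - br y z = J (br (J y) z) + J (br y (J z))"
    using kaehler by (simp add: kaehler_lie_algebra_def complex_structure_def algebra_simps)
  have "g (br (J y) (J z)) (J x) - g (br y z) (J x) = g (br (J y) z) x + g (br y (J z)) x"
    using arg_cong[OF N, of "\<lambda>v. g v (J x)"]
    by (simp add: bilinear_lsub[OF bil] bilinear_ladd[OF bil] J_isometry)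
  moreover have "g (br x (J y)) z + g (br (J z) x) y = g (br (J y) (J z)) (J x)"
    using closed[of x "J y" "J z"] by (simp add: J_J bilinear_rneg[OF bil])
  ultimately have "2 * g (levi_civita br g x (J y)) z + 2 * g (levi_civita br g x y) (J z) = 0"
    using closed[of x y z] ks[of x "J y" z] ks[of x y "J z"] by linarith
  then show "g (levi_civita br g x (J y)) z = g (J (levi_civita br g x y)) z"
    by (simp add: J_skew)
qed

end

section \<open>The reflection of a direct sum\<close>

lemma direct_sum_reflection:
  assumes "direct_sum_decomposition U V"
  obtains E where "linear E" "\<And>u. u \<in> U \<Longrightarrow> E u = u" "\<And>v. v \<in> V \<Longrightarrow> E v = - v"
proof -
  have U: "subspace U" and V: "subspace V" and UV: "U \<inter> V = {0}"
    and ex: "\<exists>u v. u \<in> U \<and> v \<in> V \<and> x = u + v" for x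
    using assms unfolding direct_sum_decomposition_def by blast+
  obtain p q where p: "\<And>x. p x \<in> U" and q: "\<And>x. q x \<in> V" and pq: "\<And>x. p x + q x = x"
    using ex by (metis (no_types))
  have unique: "p x = u \<and> q x = v" if "u \<in> U" "v \<in> V" "x = u + v" for x u v
  proof -
    have "(p x - u) - (v - q x) = (p x + q x) - (u + v)" by (simp add: algebra_simps)
    also have "\<dots> = 0" using that(3) by (simp only: pq) simp
    finally have eq: "p x - u = v - q x" by (simp only: right_minus_eq)
    have "p x - u \<in> U" "v - q x \<in> V" using p q that U V by (simp_all add: subspace_diff)
    then have "p x - u \<in> U \<inter> V" by (simp only: eq Int_iff)
    then have "p x - u = 0" by (simp only: UV) simp
    then show ?thesis using eq by simp
  qed
  have add: "p (x + y) = p x + p y \<and> q (x + y) = q x + q y" for x y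
  proof (rule unique)
    show "p x + p y \<in> U" "q x + q y \<in> V" using p q U V by (simp_all add: subspace_add)
    have "p x + p y + (q x + q y) = (p x + q x) + (p y + q y)" by (simp add: algebra_simps)
    then show "x + y = p x + p y + (q x + q y)" by (simp only: pq)
  qed
  have scale: "p (c *\<^sub>R x) = c *\<^sub>R p x \<and> q (c *\<^sub>R x) = c *\<^sub>R q x" for c x
  proof (rule unique)
    show "c *\<^sub>R p x \<in> U" "c *\<^sub>R q x \<in> V" using p q U V by (simp_all add: subspace_scale)
    show "c *\<^sub>R x = c *\<^sub>R p x + c *\<^sub>R q x" by (simp only: pq flip: scaleR_add_right)
  qed
  show thesis
  proof
    show "linear (\<lambda>x. p x - q x)"
      by (rule linearI) (simp_all add: add scale algebra_simps)
    show "p u - q u = u" if "u \<in> U" for u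
      using unique[of u 0 u] that subspace_0[OF V] by simp
    show "p v - q v = - v" if "v \<in> V" for v
      using unique[of 0 v v] that subspace_0[OF U] by simp
  qed
qed

section \<open>Kaehler metrics with a Walker subspace transverse to its image\<close>

theorem proposition6p4:
  fixes br :: "'a::real_vector \<Rightarrow> 'a \<Rightarrow> 'a"
    and J :: "'a \<Rightarrow> 'a"
    and \<omega> g :: "'a \<Rightarrow> 'a \<Rightarrow> real"
    and W :: "'a set"
  assumes "kaehler_lie_algebra br J \<omega>"
    and "g = kaehler_metric J \<omega>"
    and "walker_subspace br g W"
    and "direct_sum_decomposition W (J ` W)"
  shows "hypersymplectic_metric br g"
proof -
  note K = assms(1,2)
  note lie = kaehler_lie[OF K] and pr = kaehler_metric_pseudo_riemannian[OF K]
  note lJ = linear_J[OF K] and JJ = J_J[OF K]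
  note metric_simps = metric_simps[OF lie pr]
  note J_par = kaehler_parallel[OF K]
  let ?D = "levi_civita br g"
  obtain E where lE: "linear E" and EW: "\<And>u. u \<in> W \<Longrightarrow> E u = u"
    and EV: "\<And>v. v \<in> J ` W \<Longrightarrow> E v = - v"
    using direct_sum_reflection[OF assms(4)] by blast
  have W: "subspace W" and null: "\<And>u w. u \<in> W \<Longrightarrow> w \<in> W \<Longrightarrow> g u w = 0"
    and DW: "\<And>y w. w \<in> W \<Longrightarrow> ?D y w \<in> W"
    using assms(3) unfolding walker_subspace_def by blast+
  have JW: "subspace (J ` W)" by (rule linear_subspace_image[OF lJ W])
  have DJW: "?D y v \<in> J ` W" if "v \<in> J ` W" for y v
    using that DW J_par by auto
  have split: "\<exists>u w. u \<in> W \<and> w \<in> W \<and> x = u + J w" for x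
    using assms(4) unfolding direct_sum_decomposition_def by blast
  have EJ: "E (J w) = - J w" if "w \<in> W" for w using EV that by simp
  have E_split: "E (u + J w) = u - J w" if "u \<in> W" "w \<in> W" for u w
    using that by (simp add: linear_add[OF lE] EW EJ)
  have EE: "E (E x) = x" for x
    using split[of x] by (auto simp: E_split linear_diff[OF lE] EW EJ)
  have anti: "J (E x) = - E (J x)" for x
    using split[of x]
    by (auto simp: E_split linear_add[OF lJ] linear_diff[OF lJ] linear_diff[OF lE] JJ EW EJ)
  have E_anti_isometry: "g (E x) (E y) = - g x y" for x y
  proof -
    obtain u w u' w' where "u \<in> W" "w \<in> W" "x = u + J w" "u' \<in> W" "w' \<in> W" "y = u' + J w'"
      using split[of x] split[of y] by blast
    then show ?thesis by (simp add: E_split metric_simps null J_isometry[OF K])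
  qed
  have E_skew: "g (E x) y = - g x (E y)" for x y
    using E_anti_isometry[of x "E y"] by (simp add: EE)
  have E_par: "?D x (E y) = E (?D x y)" for x y
  proof -
    obtain u w where uw: "u \<in> W" "w \<in> W" "y = u + J w" using split[of y] by blast
    have "?D x (E y) = ?D x u - J (?D x w)"
      using uw nabla_add[OF lie pr, of x u "- J w"]
      by (simp add: E_split nabla_minus[OF lie pr] J_par)
    also have "\<dots> = E (?D x y)"
      using uw by (simp add: nabla_add[OF lie pr] J_par E_split DW)
    finally show ?thesis .
  qed
  have self_neg: "v = 0" if "v = - v" for v :: 'a
  proof -
    have "2 *\<^sub>R v = 0" using that by (simp add: scaleR_2 eq_neg_iff_add_eq_0)
    then show ?thesis by simp
  qed
  have Wfix: "{x. E x = x} = W"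
  proof -
    have "x \<in> W" if x: "E x = x" for x
    proof -
      obtain u w where uw: "u \<in> W" "w \<in> W" "x = u + J w" using split[of x] by blast
      then have "u - J w = u + J w" using x E_split[of u w] by simp
      then have "J w = 0" by (intro self_neg) (simp add: diff_conv_add_uminus del: add_uminus_conv_diff)
      then show ?thesis using uw by simp
    qed
    then show ?thesis using EW by blast
  qed
  have JWfix: "{x. E x = - x} = J ` W"
  proof -
    have "x \<in> J ` W" if x: "E x = - x" for x
    proof -
      obtain u w where uw: "u \<in> W" "w \<in> W" "x = u + J w" using split[of x] by blast
      then have "u - J w = - u - J w" using x E_split[of u w] by simp
      then have "u = 0" by (intro self_neg) simp
      then show ?thesis using uw by simp
    qed
    then show ?thesis using EV by blast
  qed
  obtain w where w: "w \<in> W" "w \<noteq> 0"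
    using assms(3) subspace_0[OF W] unfolding walker_subspace_def by blast
  have "J w \<noteq> 0" using w JJ[of w] linear_0[OF lJ] by auto
  then have "E \<noteq> (\<lambda>x. x)" using EJ[OF w(1)] self_neg[of "J w"] by auto
  moreover have "E \<noteq> (\<lambda>x. - x)" using EW[OF w(1)] w(2) self_neg[of w] by auto
  ultimately have product: "product_structure br E"
    unfolding product_structure_def Wfix JWfix
    using lE EE parallel_subspace_subalgebra[OF lie pr W DW]
      parallel_subspace_subalgebra[OF lie pr JW DJW] by blast
  have "g (J (E x)) y = - g x (J (E y))" for x y
    using J_skew[OF K, of "E x" y] E_skew[of x "J y"] anti[of y] by (simp add: metric_simps)
  then have closed_JE: "closed_two_form br (\<lambda>x y. g (J (E x)) y)"
    by (intro parallel_skew_closed[OF lie pr, of "\<lambda>x. J (E x)"])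
      (use linear_compose[OF lE lJ] in \<open>simp_all add: o_def J_par E_par\<close>)
  have "complex_structure br J" using K(1) by (simp add: kaehler_lie_algebra_def)
  then have "hypersymplectic_lie_algebra br J E g"
    unfolding hypersymplectic_lie_algebra_def
    using lie product anti pr J_isometry[OF K] E_anti_isometry closed_JE
      parallel_skew_closed[OF lie pr lJ J_skew[OF K] J_par]
      parallel_skew_closed[OF lie pr lE E_skew E_par]
    by blast
  then show ?thesis unfolding hypersymplectic_metric_def by blast
qed

end
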